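(* Let $X$ be an infinite dimensional Banach space with a weakly null Schauder basis $(e_n)$. Then $X$ can be renormed with a relative Daugavet-point; that is, there exists an equivalent norm $|||\cdot|||$ on $X$ such that $(X,|||\cdot|||)$ contains a relative Daugavet-point.
   Context: All Banach spaces are real. A basis $(e_n)$ is weakly null if $e_n\to 0$ in the weak topology. For a Banach space $Z$, $B_Z$ and $S_Z$ denote its closed unit ball and unit sphere, and $Z^*$ its topological dual. A slice of $B_Z$ is a set of the form $S(z^*,\alpha)=\{y\in B_Z:\ z^*(y)>\sup z^*(B_Z)-\alpha\}$ with $z^*\in Z^*$ and $\alpha>0$. For $z\in S_Z$ let $D(z)=\{z^*\in S_{Z^*}:\ z^*(z)=1\}$; a supporting slice at $z$ is a slice $S(z^*,\alpha)$ with $z^*\in D(z)$ and $\alpha>0$. A point $z\in S_Z$ is a Daugavet-point relative to a supporting slice $S$ at $z$ if $\sup_{y\in T}\|z-y\|=2$ for every slice $T$ of $B_Z$ with $T\subseteq S$. A point $z\in S_Z$ is a relative Daugavet-point if it is a Daugavet-point relative to some supporting slice at $z$. *)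

theory Defs
  imports "HOL-Analysis.Analysis"
begin

definition schauder_basis :: "(nat \<Rightarrow> 'a::real_normed_vector) \<Rightarrow> bool" where
  "schauder_basis e \<longleftrightarrow> (\<forall>x. \<exists>!a::nat \<Rightarrow> real. (\<lambda>n. a n *\<^sub>R e n) sums x)"

definition weak_topology :: "'a::real_normed_vector topology" where
  "weak_topology =
     topology_generated_by {f -` U | (f :: 'a \<Rightarrow> real) U. bounded_linear f \<and> open U}"

definition weakly_null :: "(nat \<Rightarrow> 'a::real_normed_vector) \<Rightarrow> bool" where
  "weakly_null e \<longleftrightarrow> limitin weak_topology e 0 sequentially"

text \<open>
  A type carries only one class norm, so a renorming is represented by an explicit function
  \<open>N\<close> on the same vector space, and the geometric notions below take \<open>N\<close> as a parameter.
\<close>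

definition is_norm :: "('a::real_vector \<Rightarrow> real) \<Rightarrow> bool" where
  "is_norm N \<longleftrightarrow>
     (\<forall>x. 0 \<le> N x) \<and> (\<forall>x. N x = 0 \<longleftrightarrow> x = 0) \<and>
     (\<forall>x y. N (x + y) \<le> N x + N y) \<and> (\<forall>r x. N (r *\<^sub>R x) = \<bar>r\<bar> * N x)"

definition equivalent_norm :: "('a::real_normed_vector \<Rightarrow> real) \<Rightarrow> bool" where
  "equivalent_norm N \<longleftrightarrow>
     is_norm N \<and> (\<exists>c>0. \<exists>C>0. \<forall>x. c * norm x \<le> N x \<and> N x \<le> C * norm x)"

definition unit_ball :: "('a::real_vector \<Rightarrow> real) \<Rightarrow> 'a set" where
  "unit_ball N = {x. N x \<le> 1}"

definition unit_sphere :: "('a::real_vector \<Rightarrow> real) \<Rightarrow> 'a set" where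
  "unit_sphere N = {x. N x = 1}"

definition dual :: "('a::real_vector \<Rightarrow> real) \<Rightarrow> ('a \<Rightarrow> real) set" where
  "dual N = {f. linear f \<and> (\<exists>K. \<forall>x. \<bar>f x\<bar> \<le> K * N x)}"

definition dual_norm :: "('a::real_vector \<Rightarrow> real) \<Rightarrow> ('a \<Rightarrow> real) \<Rightarrow> real" where
  "dual_norm N f = (SUP x\<in>unit_ball N. \<bar>f x\<bar>)"

definition slice :: "('a::real_vector \<Rightarrow> real) \<Rightarrow> ('a \<Rightarrow> real) \<Rightarrow> real \<Rightarrow> 'a set" where
  "slice N f \<alpha> = {y \<in> unit_ball N. f y > (SUP x\<in>unit_ball N. f x) - \<alpha>}"

definition is_slice :: "('a::real_vector \<Rightarrow> real) \<Rightarrow> 'a set \<Rightarrow> bool" where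
  "is_slice N T \<longleftrightarrow> (\<exists>f\<in>dual N. \<exists>\<alpha>>0. T = slice N f \<alpha>)"

definition supporting_functionals :: "('a::real_vector \<Rightarrow> real) \<Rightarrow> 'a \<Rightarrow> ('a \<Rightarrow> real) set" where
  "supporting_functionals N z = {f \<in> dual N. dual_norm N f = 1 \<and> f z = 1}"

definition supporting_slice :: "('a::real_vector \<Rightarrow> real) \<Rightarrow> 'a \<Rightarrow> 'a set \<Rightarrow> bool" where
  "supporting_slice N z S \<longleftrightarrow> (\<exists>f\<in>supporting_functionals N z. \<exists>\<alpha>>0. S = slice N f \<alpha>)"

definition daugavet_point_relative_to ::
    "('a::real_vector \<Rightarrow> real) \<Rightarrow> 'a \<Rightarrow> 'a set \<Rightarrow> bool" where
  "daugavet_point_relative_to N z S \<longleftrightarrow>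
     z \<in> unit_sphere N \<and> supporting_slice N z S \<and>
     (\<forall>T. is_slice N T \<longrightarrow> T \<subseteq> S \<longrightarrow> (SUP y\<in>T. N (z - y)) = 2)"

definition relative_daugavet_point :: "('a::real_vector \<Rightarrow> real) \<Rightarrow> 'a \<Rightarrow> bool" where
  "relative_daugavet_point N z \<longleftrightarrow> (\<exists>S. daugavet_point_relative_to N z S)"

end

theory Submission
  imports Defs
begin

text \<open>
  Fix a vector \<open>z\<close>, a bounded functional \<open>f\<close> with \<open>f z = 1\<close>, and a bounded family \<open>x\<^sub>i\<close> in the
  kernel of \<open>f\<close> with uniformly bounded biorthogonal functionals \<open>g\<^sub>i\<close> that vanish at \<open>z\<close>.  The new unit
  ball is, up to closure, the convex hull of the points \<open>\<plusminus>(z + x\<^sub>i)\<close> and of a small ball of the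
  original norm.  On the small ball \<open>f\<close> is at most \<open>1/2\<close>, and at \<open>-(z + x\<^sub>i)\<close> it is \<open>-1\<close>, so
  every slice contained in \<open>{f > 1/2}\<close> must contain one of the generators \<open>z + x\<^sub>i\<close>.  The functional
  \<open>2 g\<^sub>i - f\<close> is at most \<open>1\<close> on the ball and takes the value \<open>2\<close> at \<open>x\<^sub>i\<close>; hence \<open>z\<close> and \<open>z + x\<^sub>i\<close>
  are at distance \<open>2\<close>, the largest that two points of the ball can have.  All that is left is to make \<open>z\<close> a unit vector, and this holds as soon as
  \<open>0\<close> lies in the closed convex hull of the \<open>x\<^sub>i\<close>, because then \<open>z\<close> lies in that of the \<open>z + x\<^sub>i\<close>.
  This is lemma \<open>relative_daugavet_renorming\<close>.

  The family comes from the basis.  Normalise it to \<open>u\<^sub>n\<close>, with coordinate functionals \<open>c\<^sub>n\<close>, which are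
  uniformly bounded because the partial sum projections are; take \<open>z = u\<^sub>0\<close> and \<open>f = c\<^sub>0\<close>.  There are
  two cases.

  Either every tail of \<open>u\<close> carries finite sums \<open>\<Sum> b\<^sub>n u\<^sub>n\<close> that are small compared with
  \<open>\<Sum> \<bar>b\<^sub>n\<bar>\<close>.  Choosing such sums on successive disjoint blocks and writing \<open>\<theta>\<^sub>n\<close> for the signs of their
  coefficients, the vectors \<open>\<theta>\<^sub>n u\<^sub>n\<close> have convex combinations of arbitrarily small norm
  (\<open>signed_coordinates\<close>).

  Or some tail of \<open>u\<close> is equivalent to the unit vector basis of \<open>\<ell>\<^sub>1\<close>.  Then every choice
  of signs on the tail defines a bounded functional, with a uniform bound.  On a block of
  length \<open>2^q\<close> take for the \<open>x\<^sub>i\<close> the rows of a Hadamard matrix divided by \<open>2^q\<close>, and for the \<open>g\<^sub>i\<close> the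
  rows themselves.  Orthogonality of the rows is biorthogonality, and the columns of Sylvester's
  matrix other than the first sum to \<open>0\<close>, so the average of the \<open>x\<^sub>i\<close> is \<open>2^-q\<close> times a basis vector
  (\<open>sylvester_blocks\<close>).
\<close>

section \<open>Gauges of symmetric convex bodies\<close>

definition gauge_norm :: "'a::real_vector set \<Rightarrow> 'a \<Rightarrow> real" where
  "gauge_norm C x = Inf {t. t > 0 \<and> x /\<^sub>R t \<in> C}"

locale symmetric_convex_body =
  fixes C :: "'a::real_normed_vector set" and \<epsilon> R :: real
  assumes convex: "convex C"
    and symmetric: "x \<in> C \<Longrightarrow> - x \<in> C"
    and \<epsilon>_pos: "\<epsilon> > 0" and inner: "ball 0 \<epsilon> \<subseteq> C"
    and R_pos: "R > 0" and outer: "C \<subseteq> cball 0 R"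
begin

lemma zero_mem: "0 \<in> C"
  using inner \<epsilon>_pos by auto

lemma star_shaped:
  assumes "x \<in> C" "0 \<le> r" "r \<le> 1" shows "r *\<^sub>R x \<in> C"
  using convexD[OF convex assms(1) zero_mem, of r "1 - r"] assms by simp

lemma gauge_norm_le:
  assumes "t > 0" "x /\<^sub>R t \<in> C" shows "gauge_norm C x \<le> t"
  unfolding gauge_norm_def by (rule cInf_lower) (use assms in \<open>auto intro: bdd_belowI[of _ 0]\<close>)

lemma mem_scaled_of_norm_less:
  assumes "norm x < t * \<epsilon>" shows "t > 0 \<and> x /\<^sub>R t \<in> C"
proof -
  have "0 < t * \<epsilon>" using assms norm_ge_zero[of x] by linarith
  then have "t > 0" using \<epsilon>_pos by (simp add: zero_less_mult_iff)
  then have "norm (x /\<^sub>R t) < \<epsilon>" using assms by (simp add: field_simps)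
  then show ?thesis using inner \<open>t > 0\<close> by (auto simp: subset_iff)
qed

lemma gauge_norm_set_nonempty: "{t. t > 0 \<and> x /\<^sub>R t \<in> C} \<noteq> {}"
proof -
  have "norm x < ((norm x + 1) / \<epsilon>) * \<epsilon>" using \<epsilon>_pos by simp
  then show ?thesis using mem_scaled_of_norm_less by blast
qed

lemma gauge_norm_ge:
  assumes "\<And>t. t > 0 \<Longrightarrow> x /\<^sub>R t \<in> C \<Longrightarrow> b \<le> t" shows "b \<le> gauge_norm C x"
  unfolding gauge_norm_def by (rule cInf_greatest[OF gauge_norm_set_nonempty]) (use assms in auto)

lemma gauge_norm_less_mem:
  assumes "gauge_norm C x < t" shows "t > 0 \<and> x /\<^sub>R t \<in> C"
proof -
  obtain s where s: "s > 0" "x /\<^sub>R s \<in> C" "s < t"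
    using cInf_lessD[OF gauge_norm_set_nonempty assms[unfolded gauge_norm_def]] by auto
  then have "(s / t) *\<^sub>R (x /\<^sub>R s) \<in> C" using star_shaped[of "x /\<^sub>R s" "s / t"] by simp
  moreover have "s * inverse t * inverse s = inverse t" using s by simp
  ultimately show ?thesis using s by (simp add: divide_inverse)
qed

lemma gauge_norm_nonneg: "0 \<le> gauge_norm C x"
  by (rule gauge_norm_ge) simp

lemma gauge_norm_le_one: "x \<in> C \<Longrightarrow> gauge_norm C x \<le> 1"
  using gauge_norm_le[of 1 x] by simp

lemma gauge_norm_upper: "gauge_norm C x \<le> norm x / \<epsilon>"
proof (rule field_le_epsilon)
  fix d :: real assume "d > 0"
  then have "norm x < (norm x / \<epsilon> + d) * \<epsilon>" using \<epsilon>_pos by (simp add: field_simps)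
  then show "gauge_norm C x \<le> norm x / \<epsilon> + d"
    using mem_scaled_of_norm_less gauge_norm_le by blast
qed

text \<open>
  For a functional with \<open>\<phi> \<le> 1\<close> on \<open>C\<close> this is a lower bound on the gauge; for the functional that
  defines a slice it shows that the supremum over the unit ball is already the supremum over \<open>C\<close>.
\<close>

lemma functional_le_gauge_norm:
  assumes "linear \<phi>" "\<And>w. w \<in> C \<Longrightarrow> \<phi> w \<le> s" "0 \<le> s"
  shows "\<phi> x \<le> s * gauge_norm C x"
proof (cases "s = 0")
  case True
  have "\<phi> (x /\<^sub>R t) \<le> 0" if "gauge_norm C x < t" for t
    using assms(2) gauge_norm_less_mem[OF that] True by blast
  then have "\<phi> (x /\<^sub>R (gauge_norm C x + 1)) \<le> 0" by simp
  then show ?thesis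
    using gauge_norm_nonneg[of x] True
    by (simp add: linear_cmul[OF assms(1)] field_simps mult_le_0_iff)
next
  case False
  then have "s > 0" using assms by simp
  have "\<phi> x / s \<le> gauge_norm C x"
  proof (rule gauge_norm_ge)
    fix t :: real assume t: "t > 0" "x /\<^sub>R t \<in> C"
    then have "\<phi> x / t \<le> s"
      using assms(2)[of "x /\<^sub>R t"] by (simp add: linear_cmul[OF assms(1)] divide_inverse mult.commute)
    then show "\<phi> x / s \<le> t" using t \<open>s > 0\<close> by (simp add: field_simps)
  qed
  then show ?thesis using \<open>s > 0\<close> by (simp add: field_simps)
qed

lemma gauge_norm_lower: "norm x / R \<le> gauge_norm C x"
proof (rule gauge_norm_ge)
  fix t :: real assume t: "t > 0" "x /\<^sub>R t \<in> C"
  then have "norm (x /\<^sub>R t) \<le> R" using outer by (auto simp: subset_iff)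
  then show "norm x / R \<le> t" using t R_pos by (simp add: field_simps)
qed

lemma gauge_norm_triangle: "gauge_norm C (x + y) \<le> gauge_norm C x + gauge_norm C y"
proof (rule field_le_epsilon)
  fix d :: real assume "d > 0"
  define s t where "s = gauge_norm C x + d/2" and "t = gauge_norm C y + d/2"
  have s: "s > 0" "x /\<^sub>R s \<in> C" and t: "t > 0" "y /\<^sub>R t \<in> C"
    using gauge_norm_less_mem[of x s] gauge_norm_less_mem[of y t] \<open>d > 0\<close> by (auto simp: s_def t_def)
  have "(s / (s + t)) *\<^sub>R (x /\<^sub>R s) + (t / (s + t)) *\<^sub>R (y /\<^sub>R t) \<in> C"
    using s t by (intro convexD[OF convex]) (auto simp flip: add_divide_distrib)
  then have "(x + y) /\<^sub>R (s + t) \<in> C"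
    using s t by (simp add: scaleR_add_right field_simps)
  then have "gauge_norm C (x + y) \<le> s + t" using s t by (intro gauge_norm_le) auto
  then show "gauge_norm C (x + y) \<le> gauge_norm C x + gauge_norm C y + d"
    by (simp add: s_def t_def)
qed

lemma gauge_norm_minus: "gauge_norm C (- x) = gauge_norm C x"
  unfolding gauge_norm_def using symmetric
  by (metis (no_types, lifting) minus_minus scaleR_minus_right)

lemma gauge_norm_zero: "gauge_norm C 0 = 0"
  using gauge_norm_upper[of 0] gauge_norm_nonneg[of 0] by simp

lemma gauge_norm_scale_pos_le:
  assumes "r > 0" shows "gauge_norm C (r *\<^sub>R x) \<le> r * gauge_norm C x"
proof -
  have "gauge_norm C (r *\<^sub>R x) / r \<le> gauge_norm C x"
  proof (rule gauge_norm_ge)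
    fix t :: real assume "t > 0" "x /\<^sub>R t \<in> C"
    moreover have "(r *\<^sub>R x) /\<^sub>R (r * t) = x /\<^sub>R t"
      using assms by simp
    ultimately have "gauge_norm C (r *\<^sub>R x) \<le> r * t"
      using assms by (intro gauge_norm_le) (auto simp del: scaleR_scaleR)
    then show "gauge_norm C (r *\<^sub>R x) / r \<le> t" using assms by (simp add: field_simps)
  qed
  then show ?thesis using assms by (simp add: field_simps)
qed

lemma gauge_norm_scale: "gauge_norm C (r *\<^sub>R x) = \<bar>r\<bar> * gauge_norm C x"
proof -
  have pos: "gauge_norm C (r *\<^sub>R x) = r * gauge_norm C x" if "r > 0" for r x
    using gauge_norm_scale_pos_le[OF that, of x] that
      gauge_norm_scale_pos_le[of "inverse r" "r *\<^sub>R x"] by (simp add: field_simps)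
  consider "r = 0" | "r > 0" | "r < 0" by linarith
  then show ?thesis
  proof cases
    case 3
    then show ?thesis using pos[of "- r" x] gauge_norm_minus[of "r *\<^sub>R x"] by simp
  qed (auto simp: gauge_norm_zero pos)
qed

lemma equivalent_norm_gauge_norm: "equivalent_norm (gauge_norm C)"
proof -
  have "is_norm (gauge_norm C)"
    unfolding is_norm_def
  proof (intro conjI allI)
    show "gauge_norm C x = 0 \<longleftrightarrow> x = 0" for x
    proof
      assume "gauge_norm C x = 0"
      then have "norm x / R \<le> 0" using gauge_norm_lower[of x] by simp
      then show "x = 0" using R_pos by (simp add: field_simps)
    qed (simp add: gauge_norm_zero)
  qed (auto simp: gauge_norm_nonneg gauge_norm_triangle gauge_norm_scale)
  moreover have "\<forall>x. (1/R) * norm x \<le> gauge_norm C x \<and> gauge_norm C x \<le> (1/\<epsilon>) * norm x"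
    using gauge_norm_lower gauge_norm_upper by simp
  ultimately show ?thesis
    unfolding equivalent_norm_def using R_pos \<epsilon>_pos by (meson zero_less_divide_1_iff)
qed

text \<open>
  The set \<open>C\<close> need not be closed; the unit ball of its gauge contains the closure because the gauge is
  continuous for the original norm.
\<close>

lemma gauge_norm_closure:
  assumes "x \<in> closure C" shows "gauge_norm C x \<le> 1"
proof (rule field_le_epsilon)
  fix d :: real assume "d > 0"
  then obtain y where y: "y \<in> C" "dist y x < d * \<epsilon>"
    using assms \<epsilon>_pos unfolding closure_approachable by (meson mult_pos_pos)
  have "gauge_norm C x \<le> gauge_norm C y + gauge_norm C (x - y)"
    using gauge_norm_triangle[of y "x - y"] by simp
  also have "gauge_norm C (x - y) \<le> d"
  proof -
    have "norm (x - y) / \<epsilon> \<le> d"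
      using y(2) \<epsilon>_pos by (simp add: dist_norm norm_minus_commute pos_divide_le_eq)
    then show ?thesis using gauge_norm_upper[of "x - y"] by linarith
  qed
  finally show "gauge_norm C x \<le> 1 + d" using gauge_norm_le_one[OF y(1)] by simp
qed

end

section \<open>Renorming along a biorthogonal family\<close>

text \<open>
  The unit ball is generated so that every slice contained in \<open>{f > 1/2}\<close> contains one of the points
  \<open>z + x\<^sub>i\<close>, while \<open>2 g\<^sub>i - f\<close> shows that these points have distance \<open>2\<close> from \<open>z\<close>.  The hypothesis on the
  closed convex hull puts \<open>z\<close> itself into the ball.
\<close>

lemma relative_daugavet_renorming:
  fixes z :: "'a::real_normed_vector" and f :: "'a \<Rightarrow> real" and x :: "'i \<Rightarrow> 'a" and g :: "'i \<Rightarrow> 'a \<Rightarrow> real"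
  assumes f: "bounded_linear f" and fz: "f z = 1" and fx: "\<And>i. i \<in> I \<Longrightarrow> f (x i) = 0"
    and g: "\<And>i. i \<in> I \<Longrightarrow> linear (g i)" and gz: "\<And>i. i \<in> I \<Longrightarrow> g i z = 0"
    and gx: "\<And>i j. i \<in> I \<Longrightarrow> j \<in> I \<Longrightarrow> g i (x j) = (if i = j then 1 else 0)"
    and g_bound: "\<And>i y. i \<in> I \<Longrightarrow> \<bar>g i y\<bar> \<le> G * norm y"
    and x_bound: "bounded (x ` I)"
    and hull: "0 \<in> closure (convex hull (x ` I))"
  obtains N where "equivalent_norm N" "relative_daugavet_point N z"
proof -
  interpret f: bounded_linear f by fact
  have f_neg: "f (- y) = - f y" for y
    by (rule linear_neg) (rule f.linear_axioms)
  obtain L where "L > 0" and L: "\<And>y. \<bar>f y\<bar> \<le> norm y * L"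
    using f.pos_bounded by (auto simp: real_norm_def)
  \<comment> \<open>the radius for which \<open>f\<close> is at most \<open>1/2\<close> and \<open>2 g\<^sub>i - f\<close> at most \<open>1\<close> on the small ball\<close>
  define \<epsilon> where "\<epsilon> = 1 / (2 * L + 2 * \<bar>G\<bar>)"
  have "\<epsilon> > 0" using \<open>L > 0\<close> by (simp add: \<epsilon>_def)
  have small: "\<bar>f y\<bar> \<le> 1/2" "i \<in> I \<Longrightarrow> \<bar>2 * g i y - f y\<bar> \<le> 1" if "y \<in> ball 0 \<epsilon>" for y i
  proof -
    have y: "norm y * L + norm y * \<bar>G\<bar> \<le> 1/2"
      using that \<open>L > 0\<close> unfolding \<epsilon>_def by (simp add: field_simps)
    have "0 \<le> norm y * \<bar>G\<bar>" "0 \<le> norm y * L" using \<open>L > 0\<close> by auto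
    then show "\<bar>f y\<bar> \<le> 1/2" using y L[of y] by linarith
    assume "i \<in> I"
    have "\<bar>g i y\<bar> \<le> norm y * \<bar>G\<bar>"
      using g_bound[OF \<open>i \<in> I\<close>, of y] mult_right_mono[OF abs_ge_self[of G], of "norm y"]
      by (simp add: mult.commute)
    then show "\<bar>2 * g i y - f y\<bar> \<le> 1"
      using y L[of y] \<open>0 \<le> norm y * L\<close> by linarith
  qed
  define P where "P = (\<lambda>i. z + x i) ` I"
  define C where "C = convex hull (P \<union> uminus ` P \<union> ball 0 \<epsilon>)"
  have gen: "P \<union> uminus ` P \<union> ball 0 \<epsilon> \<subseteq> C"
    unfolding C_def by (rule hull_subset)
  obtain R where "R > 0" and R: "C \<subseteq> cball 0 R"
  proof -
    have "P = (+) z ` (x ` I)" unfolding P_def by auto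
    then have "bounded P" using x_bound by (simp add: bounded_translation)
    then have "bounded C"
      unfolding C_def by (intro bounded_convex_hull) (simp add: bounded_uminus)
    then obtain R where "R > 0" "\<forall>y\<in>C. norm y \<le> R" unfolding bounded_pos by blast
    then have "C \<subseteq> cball 0 R" by auto
    then show ?thesis using that \<open>R > 0\<close> by blast
  qed
  have symC: "- y \<in> C" if "y \<in> C" for y
  proof -
    have "uminus ` ball (0::'a) \<epsilon> = ball 0 \<epsilon>"
    proof (intro equalityI subsetI)
      fix y :: 'a assume "y \<in> ball 0 \<epsilon>"
      then have "- (- y) \<in> uminus ` ball 0 \<epsilon>" by (intro imageI) simp
      then show "y \<in> uminus ` ball 0 \<epsilon>" by simp
    qed auto
    then have "uminus ` (P \<union> uminus ` P \<union> ball 0 \<epsilon>) = P \<union> uminus ` P \<union> ball 0 \<epsilon>"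
      by (auto simp: image_Un image_image)
    then have "uminus ` C = C"
      unfolding C_def by (metis convex_hull_linear_image linear_uminus)
    then show ?thesis using that by (metis imageI)
  qed
  interpret C: symmetric_convex_body C \<epsilon> R
    by unfold_locales (use gen symC \<open>\<epsilon> > 0\<close> \<open>R > 0\<close> R in \<open>auto simp: C_def convex_convex_hull\<close>)
  define N where "N = gauge_norm C"
  have N_C: "N y \<le> 1" if "y \<in> C" for y
    unfolding N_def using that by (rule C.gauge_norm_le_one)
  have N_triangle: "N (v + w) \<le> N v + N w" for v w
    unfolding N_def by (rule C.gauge_norm_triangle)
  have N_minus: "N (- v) = N v" for v
    unfolding N_def by (rule C.gauge_norm_minus)
  have functional_bound: "\<phi> y \<le> s * N y"
    if "linear \<phi>" "0 \<le> s" "\<And>w. w \<in> P \<union> uminus ` P \<union> ball 0 \<epsilon> \<Longrightarrow> \<phi> w \<le> s" for \<phi> :: "'a \<Rightarrow> real" and s y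
  proof -
    have "C \<subseteq> {w. \<phi> w \<le> s}"
      unfolding C_def
    proof (rule hull_minimal)
      have "{w. \<phi> w \<le> s} = \<phi> -` {..s}" by auto
      then show "convex {w. \<phi> w \<le> s}"
        using convex_linear_vimage[OF that(1), of "{..s}"] by simp
    qed (use that(3) in blast)
    then show ?thesis
      unfolding N_def using that by (intro C.functional_le_gauge_norm) auto
  qed
  have f_N: "f y \<le> N y" for y
  proof -
    have "f w \<le> 1" if "w \<in> P \<union> uminus ` P \<union> ball 0 \<epsilon>" for w
      using that small(1)[of w] by (auto simp: P_def f.add f.diff f_neg fz fx)
    from functional_bound[OF f.linear_axioms zero_le_one this, of y] show ?thesis by simp
  qed
  have N_z: "N z = 1"
  proof -
    have "z \<in> closure C"
    proof -
      have "(+) z ` (convex hull (x ` I)) = convex hull P"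
        by (simp add: P_def convex_hull_translation[symmetric] image_image)
      also have "\<dots> \<subseteq> C" unfolding C_def by (intro hull_mono) auto
      finally have "(+) z ` closure (convex hull (x ` I)) \<subseteq> closure C"
        by (metis closure_mono closure_translation)
      then show ?thesis using hull by force
    qed
    then have "N z \<le> 1" unfolding N_def by (rule C.gauge_norm_closure)
    then show ?thesis using f_N[of z] fz by simp
  qed
  have N_x: "N (x i) = 2" if "i \<in> I" for i
  proof -
    have "N (x i) \<le> N (z + x i) + N (- z)"
      using N_triangle[of "z + x i" "- z"] by simp
    also have "\<dots> \<le> 2"
      using N_C[of "z + x i"] gen that N_z N_minus[of z] by (auto simp: P_def)
    finally have "N (x i) \<le> 2" .
    \<comment> \<open>\<open>2 g\<^sub>i - f\<close> is \<open>1\<close> at \<open>z + x\<^sub>i\<close> and \<open>-1\<close> at every other \<open>z + x\<^sub>j\<close>\<close>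
    have lin: "linear (\<lambda>y. 2 * g i y - f y)"
      using linear_add[OF g[OF that]] linear_cmul[OF g[OF that]]
      by (intro linearI) (simp_all add: f.add f.scaleR algebra_simps)
    have "2 * g i w - f w \<le> 1" if "w \<in> P \<union> uminus ` P \<union> ball 0 \<epsilon>" for w
      using that small(2)[OF _ \<open>i \<in> I\<close>, of w] g[OF \<open>i \<in> I\<close>]
      by (auto simp: P_def f.add f.diff f_neg fz fx linear_add linear_diff linear_neg gx gz \<open>i \<in> I\<close>)
    from functional_bound[OF lin zero_le_one this, of "x i"]
    have "2 \<le> N (x i)" using gx[OF that that] fx[OF that] by simp
    then show ?thesis using \<open>N (x i) \<le> 2\<close> by simp
  qed
  have z_ball: "z \<in> unit_ball N" by (simp add: unit_ball_def N_z)
  have f_sup: "(SUP y\<in>unit_ball N. f y) = 1" "dual_norm N f = 1"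
  proof -
    have abs: "\<bar>f y\<bar> \<le> 1" if "y \<in> unit_ball N" for y
      using that f_N[of y] f_N[of "- y"] N_minus[of y] by (simp add: unit_ball_def f_neg)
    show "(SUP y\<in>unit_ball N. f y) = 1"
      by (rule cSup_eq_maximum) (use abs z_ball fz in \<open>force+\<close>)
    show "dual_norm N f = 1"
      unfolding dual_norm_def by (rule cSup_eq_maximum) (use abs z_ball fz in \<open>force+\<close>)
  qed
  have "f \<in> supporting_functionals N z"
  proof -
    have "\<bar>f y\<bar> \<le> 1 * N y" for y
      using f_N[of y] f_N[of "- y"] N_minus[of y] by (simp add: f_neg)
    then show ?thesis
      unfolding supporting_functionals_def dual_def using f.linear_axioms f_sup(2) fz by blast
  qed
  define S where "S = slice N f (1/2)"
  have "(SUP y\<in>T. N (z - y)) = 2" if T_slice: "is_slice N T" and T_S: "T \<subseteq> S" for T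
  proof -
    obtain \<phi> \<alpha> where \<phi>: "\<phi> \<in> dual N" and "\<alpha> > 0" and T: "T = slice N \<phi> \<alpha>"
      using T_slice unfolding is_slice_def by blast
    have lin\<phi>: "linear \<phi>"
      using \<phi> by (simp add: dual_def)
    define s where "s = (SUP y\<in>unit_ball N. \<phi> y)"
    \<comment> \<open>a slice is cut off by an open half space, so it meets the generating set\<close>
    have "\<exists>w\<in>P \<union> uminus ` P \<union> ball 0 \<epsilon>. \<phi> w > s - \<alpha>"
    proof (rule ccontr)
      assume "\<not> ?thesis"
      then have le: "\<phi> w \<le> s - \<alpha>" if "w \<in> P \<union> uminus ` P \<union> ball 0 \<epsilon>" for w
        using that by (meson not_less)
      have "0 \<le> s - \<alpha>"
        using le[of 0] \<open>\<epsilon> > 0\<close> linear_0[OF lin\<phi>] by simp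
      have "s \<le> s - \<alpha>"
      proof -
        have "\<phi> y \<le> s - \<alpha>" if "y \<in> unit_ball N" for y
        proof -
          have "\<phi> y \<le> (s - \<alpha>) * N y"
            by (rule functional_bound[OF lin\<phi> \<open>0 \<le> s - \<alpha>\<close> le])
          also have "\<dots> \<le> s - \<alpha>"
            using that mult_left_mono[of "N y" 1 "s - \<alpha>"] \<open>0 \<le> s - \<alpha>\<close> by (simp add: unit_ball_def)
          finally show ?thesis .
        qed
        then show "s \<le> s - \<alpha>"
          using z_ball unfolding s_def by (intro cSUP_least) auto
      qed
      then show False using \<open>\<alpha> > 0\<close> by simp
    qed
    then obtain w where w: "w \<in> P \<union> uminus ` P \<union> ball 0 \<epsilon>" "\<phi> w > s - \<alpha>" by blast
    have "w \<in> T"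
      using w N_C[of w] gen by (auto simp: T slice_def s_def unit_ball_def)
    then have "f w > 1/2"
      using T_S f_sup(1) by (auto simp: S_def slice_def)
    then obtain i where i: "i \<in> I" "w = z + x i"
      using w(1) small(1)[of w] by (auto simp: P_def f.add f.diff f_neg fz fx)
    show ?thesis
    proof (rule cSup_eq_maximum)
      have "N (z - w) = 2" using N_x[OF i(1)] N_minus[of "x i"] i(2) by simp
      then show "2 \<in> (\<lambda>y. N (z - y)) ` T" using \<open>w \<in> T\<close> by (metis imageI)
    next
      fix r assume "r \<in> (\<lambda>y. N (z - y)) ` T"
      then obtain y where "y \<in> T" "r = N (z - y)" by blast
      then show "r \<le> 2"
        using N_triangle[of z "- y"] N_minus[of y] N_z by (auto simp: T slice_def unit_ball_def)
    qed
  qed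
  moreover have "supporting_slice N z S"
    unfolding supporting_slice_def S_def using \<open>f \<in> supporting_functionals N z\<close>
    by (intro bexI[of _ f] exI[of _ "1/2"]) auto
  ultimately have "daugavet_point_relative_to N z S"
    unfolding daugavet_point_relative_to_def using N_z by (simp add: unit_sphere_def)
  then have "relative_daugavet_point N z"
    unfolding relative_daugavet_point_def by blast
  moreover have "equivalent_norm N"
    unfolding N_def by (rule C.equivalent_norm_gauge_norm)
  ultimately show thesis using that by blast
qed

section \<open>Bounded partial sums of a Schauder basis\<close>

text \<open>
  Zabreiko's lemma.  By Baire's theorem the closure of some set \<open>{p \<le> n}\<close> has an interior point, and by
  symmetry and subadditivity every \<open>x\<close> can be approximated, to within half of its norm, by some \<open>w\<close>
  with \<open>p w \<le> M \<parallel>x\<parallel>\<close>.  Iterating on the remainders writes \<open>x\<close> as a series along which \<open>p\<close> decays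
  geometrically, and countable subadditivity sums up the bounds.
\<close>

lemma countably_subadditive_seminorm_bounded:
  fixes p :: "'a::banach \<Rightarrow> real"
  assumes nonneg: "\<And>x. 0 \<le> p x"
    and scale: "\<And>r x. p (r *\<^sub>R x) = \<bar>r\<bar> * p x"
    and triangle: "\<And>x y. p (x + y) \<le> p x + p y"
    and countable: "\<And>s x. s sums x \<Longrightarrow> summable (\<lambda>k. p (s k)) \<Longrightarrow> p x \<le> (\<Sum>k. p (s k))"
  obtains K where "K > 0" "\<And>x. p x \<le> K * norm x"
proof -
  define F where "F n = closure {x. p x \<le> real n}" for n :: nat
  have "\<exists>n. interior (F n) \<noteq> {}"
  proof (rule ccontr)
    assume "\<not> ?thesis"
    then have "euclidean interior_of \<Union>(range F) = {}"
      by (intro Baire_category_alt) (auto simp: F_def completely_metrizable_space_euclidean)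
    moreover have "\<Union>(range F) = UNIV"
    proof -
      have "x \<in> F (nat \<lceil>p x\<rceil>)" for x
        unfolding F_def using closure_subset[of "{y. p y \<le> real (nat \<lceil>p x\<rceil>)}"]
        by (auto simp: real_nat_ceiling_ge)
      then show ?thesis by blast
    qed
    ultimately show False by simp
  qed
  then obtain n y where "y \<in> interior (F n)" by blast
  then obtain r where "r > 0" and r: "ball y r \<subseteq> F n"
    by (meson mem_interior)
  have neg: "p (- x) = p x" for x
    using scale[of "-1" x] by simp
  have approx: "\<exists>w. p w \<le> 2 * real n \<and> norm (x - w) < \<delta>" if "norm x < r" "\<delta> > 0" for x \<delta>
  proof -
    have "y \<in> F n" "y + x \<in> F n"
      using r \<open>r > 0\<close> that(1) by (auto simp: subset_iff dist_norm)
    then obtain v u where v: "p v \<le> n" "dist v y < \<delta>/2" and u: "p u \<le> n" "dist u (y + x) < \<delta>/2"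
      unfolding F_def closure_approachable using \<open>\<delta> > 0\<close> by (metis half_gt_zero mem_Collect_eq)
    have "p (u - v) \<le> 2 * real n"
      using triangle[of u "-v"] neg[of v] u v by simp
    moreover have "norm (x - (u - v)) < \<delta>"
    proof -
      have "x - (u - v) = (v - y) - (u - (y + x))" by simp
      then show ?thesis
        unfolding \<open>x - (u - v) = _\<close>
        using u(2) v(2) norm_triangle_ineq4[of "v - y" "u - (y + x)"] unfolding dist_norm by linarith
    qed
    ultimately show ?thesis by blast
  qed
  define M where "M = 4 * real n / r"
  have "M \<ge> 0" using \<open>r > 0\<close> by (simp add: M_def)
  have "\<exists>w. p w \<le> M * norm x \<and> norm (x - w) \<le> norm x / 2" for x
  proof (cases "x = 0")
    case True
    then show ?thesis using scale[of 0 0] by (intro exI[of _ 0]) auto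
  next
    case False
    define t where "t = r / (2 * norm x)"
    have "t > 0" using False \<open>r > 0\<close> by (simp add: t_def)
    have "norm (t *\<^sub>R x) < r" using False \<open>r > 0\<close> by (simp add: t_def)
    then obtain w where w: "p w \<le> 2 * real n" "norm (t *\<^sub>R x - w) < t * (norm x / 2)"
      using approx[of "t *\<^sub>R x" "t * (norm x / 2)"] \<open>t > 0\<close> False by auto
    have "p (w /\<^sub>R t) \<le> M * norm x"
      using w(1) \<open>t > 0\<close> \<open>r > 0\<close> False by (simp add: scale M_def t_def field_simps)
    moreover have "norm (x - w /\<^sub>R t) \<le> norm x / 2"
    proof -
      have "t *\<^sub>R x - w = t *\<^sub>R (x - w /\<^sub>R t)"
        using \<open>t > 0\<close> by (simp add: algebra_simps)
      then show ?thesis using w(2) \<open>t > 0\<close> by simp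
    qed
    ultimately show ?thesis by blast
  qed
  then obtain w where w: "\<And>x. p (w x) \<le> M * norm x" "\<And>x. norm (x - w x) \<le> norm x / 2"
    by metis
  have "p x \<le> (2 * M + 1) * norm x" for x
  proof -
    define z where "z k = ((\<lambda>v. v - w v) ^^ k) x" for k
    have z: "z 0 = x" "z (Suc k) = z k - w (z k)" for k
      by (auto simp: z_def)
    have nz: "norm (z k) \<le> norm x * (1/2)^k" for k
    proof (induction k)
      case (Suc k)
      then show ?case using w(2)[of "z k"] by (simp add: z)
    qed (simp add: z)
    have "z \<longlonglongrightarrow> 0"
    proof (rule Lim_null_comparison)
      show "\<forall>\<^sub>F k in sequentially. norm (z k) \<le> norm x * (1/2)^k" using nz by simp
      show "(\<lambda>k. norm x * (1/2)^k) \<longlonglongrightarrow> 0"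
        using LIMSEQ_realpow_zero[of "1/2"] tendsto_mult_right_zero by auto
    qed
    moreover have "(\<Sum>i<k. w (z i)) = x - z k" for k
      by (induction k) (auto simp: z)
    ultimately have "(\<lambda>k. w (z k)) sums x"
      unfolding sums_def using tendsto_diff[OF tendsto_const, of z 0 sequentially x] by simp
    have geo: "(\<lambda>k. M * norm x * (1/2)^k) sums (M * norm x * 2)"
      using sums_mult[OF geometric_sums[of "1/2::real"], of "M * norm x"] by simp
    have le: "p (w (z k)) \<le> M * norm x * (1/2)^k" for k
      using w(1)[of "z k"] mult_left_mono[OF nz[of k] \<open>M \<ge> 0\<close>] by (simp add: mult.assoc)
    have sm: "summable (\<lambda>k. p (w (z k)))"
      by (rule summable_comparison_test[OF _ sums_summable[OF geo]]) (use le nonneg in auto)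
    have "p x \<le> (\<Sum>k. p (w (z k)))"
      using countable \<open>(\<lambda>k. w (z k)) sums x\<close> sm by blast
    also have "\<dots> \<le> M * norm x * 2"
      using suminf_le[OF le sm sums_summable[OF geo]] geo by (simp add: sums_iff)
    also have "\<dots> \<le> (2 * M + 1) * norm x" by (simp add: algebra_simps)
    finally show ?thesis .
  qed
  then show thesis using that[of "2 * M + 1"] \<open>M \<ge> 0\<close> by simp
qed

text \<open>
  Banach's theorem that the partial sum projections \<open>S\<^sub>m\<close> of a Schauder basis are uniformly bounded.
  Zabreiko's lemma applies to the seminorm \<open>p x = sup\<^sub>m \<parallel>S\<^sub>m x\<parallel>\<close>.  It is countably subadditive since, when
  \<open>\<Sum> p(s\<^sub>k)\<close> converges, the coefficients of the terms \<open>s\<^sub>k\<close> may be summed one by one, and by dominated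
  convergence the resulting series represents \<open>\<Sum> s\<^sub>k\<close>; uniqueness of the expansion
  identifies its coefficients.
\<close>

lemma schauder_basis_normalised:
  fixes e :: "nat \<Rightarrow> 'a::banach"
  assumes "schauder_basis e"
  obtains u :: "nat \<Rightarrow> 'a" and c :: "nat \<Rightarrow> 'a \<Rightarrow> real" and K :: real
  where "\<And>n. norm (u n) = 1" "\<And>n. linear (c n)"
    "\<And>n m. c n (u m) = (if n = m then 1 else 0)"
    "K > 0" "\<And>m x. norm (\<Sum>n<m. c n x *\<^sub>R u n) \<le> K * norm x"
proof -
  obtain a :: "'a \<Rightarrow> nat \<Rightarrow> real" where a: "\<And>x. (\<lambda>n. a x n *\<^sub>R e n) sums x"
    and uniq: "\<And>x b. (\<lambda>n. b n *\<^sub>R e n) sums x \<Longrightarrow> b = a x"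
    using assms unfolding schauder_basis_def by metis
  have a_add: "a (x + y) n = a x n + a y n" for x y n
    using uniq[of "\<lambda>n. a x n + a y n" "x + y"] sums_add[OF a a, of x y]
    by (simp add: scaleR_add_left fun_eq_iff)
  have a_scale: "a (r *\<^sub>R x) n = r * a x n" for r x n
    using uniq[of "\<lambda>n. r * a x n" "r *\<^sub>R x"] sums_scaleR_right[OF a, of r x]
    by (simp add: fun_eq_iff)
  have a_e: "a (e m) n = (if n = m then 1 else 0)" for m n
  proof -
    have "(\<lambda>n. (if n = m then 1 else 0) *\<^sub>R e n) sums e m"
    proof -
      have "(\<lambda>n. (if n = m then 1 else 0) *\<^sub>R e n) = (\<lambda>n. if n = m then e n else 0)" by auto
      then show ?thesis using sums_single[of m e] by simp
    qed
    from uniq[OF this] show ?thesis by (metis (lifting))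
  qed
  have e_nz: "e n \<noteq> 0" for n
    using a_e[of n n] a_scale[of 0 "e n" n] by auto
  define S where "S m x = (\<Sum>n<m. a x n *\<^sub>R e n)" for m x
  have S_lim: "(\<lambda>m. S m x) \<longlonglongrightarrow> x" for x
    using a[of x] by (simp add: sums_def S_def)
  have S_add: "S m (x + y) = S m x + S m y" for m x y
    by (simp add: S_def a_add scaleR_add_left sum.distrib)
  have S_scale: "S m (r *\<^sub>R x) = r *\<^sub>R S m x" for m r x
    by (simp add: S_def a_scale scaleR_sum_right)
  have S_diff: "a x n *\<^sub>R e n = S (Suc n) x - S n x" for n x
    by (simp add: S_def)
  define p where "p x = (SUP m. norm (S m x))" for x
  have bdd: "bdd_above (range (\<lambda>m. norm (S m x)))" for x
    using convergent_imp_Bseq[of "\<lambda>m. S m x"] S_lim[of x]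
    by (auto simp: convergent_def Bseq_def bdd_above_def)
  have S_p: "norm (S m x) \<le> p x" for m x
    unfolding p_def by (rule cSUP_upper[OF _ bdd]) simp
  have p_le: "p x \<le> b" if "\<And>m. norm (S m x) \<le> b" for x b
    unfolding p_def by (rule cSUP_least) (use that in auto)
  have p_nonneg: "0 \<le> p x" for x
    using S_p[of 0 x] norm_ge_zero order_trans by blast
  have norm_p: "norm x \<le> p x" for x
    by (rule LIMSEQ_le_const2[OF tendsto_norm[OF S_lim]]) (use S_p in auto)
  have p_scale_le: "p (r *\<^sub>R x) \<le> \<bar>r\<bar> * p x" for r x
    by (rule p_le) (simp add: S_scale S_p mult_left_mono)
  have p_scale: "p (r *\<^sub>R x) = \<bar>r\<bar> * p x" for r x
  proof (cases "r = 0")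
    case True
    then show ?thesis using p_scale_le[of r x] p_nonneg[of "r *\<^sub>R x"] by simp
  next
    case False
    then have "\<bar>r\<bar> * p x \<le> p (r *\<^sub>R x)"
      using p_scale_le[of "inverse r" "r *\<^sub>R x"] by (simp add: field_simps)
    then show ?thesis using p_scale_le[of r x] by simp
  qed
  have p_triangle: "p (x + y) \<le> p x + p y" for x y
    by (rule p_le) (metis S_add S_p add_mono norm_triangle_ineq order_trans)
  have p_countable: "p x \<le> (\<Sum>k. p (s k))" if s: "s sums x" and sm: "summable (\<lambda>k. p (s k))" for s x
  proof -
    have coeff: "norm (a y n *\<^sub>R e n) \<le> 2 * p y" for y n
      unfolding S_diff using norm_triangle_ineq4[of "S (Suc n) y" "S n y"] S_p[of "Suc n" y] S_p[of n y]
      by simp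
    have sum_a: "summable (\<lambda>k. a (s k) n)" for n
    proof (rule summable_comparison_test)
      show "\<exists>N. \<forall>k\<ge>N. norm (a (s k) n) \<le> 2 * p (s k) / norm (e n)"
      proof (intro exI[of _ 0] allI impI)
        show "norm (a (s k) n) \<le> 2 * p (s k) / norm (e n)" for k
          using coeff[of "s k" n] e_nz[of n] by (simp add: pos_le_divide_eq)
      qed
      show "summable (\<lambda>k. 2 * p (s k) / norm (e n))"
        by (intro summable_divide summable_mult sm)
    qed
    define b where "b n = (\<Sum>k. a (s k) n)" for n
    have S_sums: "(\<lambda>k. S m (s k)) sums (\<Sum>n<m. b n *\<^sub>R e n)" for m
      unfolding S_def b_def
      by (intro sums_sum sums_scaleR_left summable_sums sum_a)
    \<comment> \<open>dominated convergence in \<open>m\<close> for the series \<open>\<Sum>\<^sub>k (S\<^sub>m s\<^sub>k - s\<^sub>k)\<close>\<close>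
    have "(\<lambda>n. b n *\<^sub>R e n) sums x"
    proof -
      have lim0: "(\<lambda>m. norm (S m (s k) - s k)) \<longlonglongrightarrow> 0" for k
        using S_lim[of "s k"] LIM_zero tendsto_norm_zero by blast
      have bound: "norm (S m (s k) - s k) \<le> 2 * p (s k)" for m k
        using norm_triangle_ineq4[of "S m (s k)" "s k"] S_p[of m "s k"] norm_p[of "s k"] by simp
      have smn: "summable (\<lambda>k. norm (S m (s k) - s k))" for m
        by (rule summable_comparison_test[OF _ summable_mult[OF sm, of 2]]) (use bound in auto)
      have "(\<lambda>m. \<Sum>k. norm (S m (s k) - s k)) \<longlonglongrightarrow> (\<Sum>k. 0::real)"
        using tannerys_theorem[OF lim0, where M = "\<lambda>k. 2 * p (s k)"] bound summable_mult[OF sm, of 2]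
        by (simp add: case_prod_unfold)
      then have "(\<lambda>m. \<Sum>k. norm (S m (s k) - s k)) \<longlonglongrightarrow> 0" by simp
      moreover have "norm ((\<Sum>n<m. b n *\<^sub>R e n) - x) \<le> (\<Sum>k. norm (S m (s k) - s k))" for m
        using sums_unique[OF sums_diff[OF S_sums[of m] s]] summable_norm[OF smn[of m]] by simp
      ultimately have "(\<lambda>m. (\<Sum>n<m. b n *\<^sub>R e n) - x) \<longlonglongrightarrow> 0"
        by (intro Lim_null_comparison[of "\<lambda>m. (\<Sum>n<m. b n *\<^sub>R e n) - x"]) auto
      then show ?thesis unfolding sums_def by (rule LIM_zero_cancel)
    qed
    then have "b = a x" by (rule uniq)
    show ?thesis
    proof (rule p_le)
      fix m
      have smS: "summable (\<lambda>k. norm (S m (s k)))"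
        by (rule summable_comparison_test[OF _ sm]) (use S_p in auto)
      have "norm (S m x) \<le> (\<Sum>k. norm (S m (s k)))"
        using S_sums[of m] summable_norm[OF smS] by (simp add: S_def[of m x] \<open>b = a x\<close> sums_iff)
      also have "\<dots> \<le> (\<Sum>k. p (s k))"
        by (rule suminf_le[OF S_p smS sm])
      finally show "norm (S m x) \<le> (\<Sum>k. p (s k))" .
    qed
  qed
  obtain K where "K > 0" and K: "\<And>x. p x \<le> K * norm x"
    using countably_subadditive_seminorm_bounded[OF p_nonneg p_scale p_triangle p_countable] by metis
  show thesis
  proof
    show "norm (e n /\<^sub>R norm (e n)) = 1" for n using e_nz by simp
    show "linear (\<lambda>x. norm (e n) * a x n)" for n
      by (rule linearI) (auto simp: a_add a_scale algebra_simps)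
    show "norm (e n) * a (e m /\<^sub>R norm (e m)) n = (if n = m then 1 else 0)" for n m
      using e_nz by (simp add: a_scale a_e)
    show "K > 0" by fact
    show "norm (\<Sum>n<m. (norm (e n) * a x n) *\<^sub>R (e n /\<^sub>R norm (e n))) \<le> K * norm x" for m x
    proof -
      have eq: "(norm (e n) * a x n) *\<^sub>R (e n /\<^sub>R norm (e n)) = a x n *\<^sub>R e n" for n
        using e_nz[of n] by simp
      show ?thesis unfolding eq using order_trans[OF S_p K, of m x] unfolding S_def .
    qed
  qed
qed

section \<open>Hadamard matrices\<close>

text \<open>
  Sylvester's Hadamard matrix of order \<open>2^q\<close>: the entry is \<open>-1\<close> to the number of the last \<open>q\<close>
  binary places in which both \<open>i\<close> and \<open>j\<close> have the digit \<open>1\<close>.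
\<close>

fun sylvester :: "nat \<Rightarrow> nat \<Rightarrow> nat \<Rightarrow> real" where
  "sylvester 0 i j = 1"
| "sylvester (Suc q) i j = (if odd i \<and> odd j then -1 else 1) * sylvester q (i div 2) (j div 2)"

lemma abs_sylvester: "\<bar>sylvester q i j\<bar> = 1"
  by (induction q arbitrary: i j) (auto simp: abs_mult)

lemma sylvester_sym: "sylvester q i j = sylvester q j i"
  by (induction q arbitrary: i j) auto

lemma sylvester_zero: "sylvester q i 0 = 1"
  by (induction q arbitrary: i) auto

text \<open>
  Splitting the columns by parity gives \<open>1 + \<sigma>\<close> times the same sum for the halved indices, where \<open>\<sigma>\<close> is
  \<open>1\<close> or \<open>-1\<close> according to whether the last digits of \<open>i\<close> and \<open>i'\<close> agree.
\<close>

lemma sylvester_orthogonal: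
  assumes "i < 2^q" "i' < 2^q"
  shows "(\<Sum>j<2^q. sylvester q i j * sylvester q i' j) = (if i = i' then 2^q else 0)"
  using assms
proof (induction q arbitrary: i i')
  case (Suc q)
  define h where "h j = sylvester q (i div 2) j * sylvester q (i' div 2) j" for j
  define \<sigma> :: real where "\<sigma> = (if odd i = odd i' then 1 else -1)"
  have split: "(\<Sum>j<2*n. F j) = (\<Sum>j<n. F (2*j)) + (\<Sum>j<n. F (2*j+1))" for n and F :: "nat \<Rightarrow> real"
    by (induction n) auto
  have "(\<Sum>j<2^Suc q. sylvester (Suc q) i j * sylvester (Suc q) i' j) = (\<Sum>j<2^q. h j) + (\<Sum>j<2^q. \<sigma> * h j)"
    unfolding power_Suc split by (intro arg_cong2[of _ _ _ _ "(+)"] sum.cong) (auto simp: h_def \<sigma>_def)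
  also have "\<dots> = (1 + \<sigma>) * (\<Sum>j<2^q. h j)"
    by (simp add: sum_distrib_left[symmetric] algebra_simps)
  also have "(\<Sum>j<2^q. h j) = (if i div 2 = i' div 2 then 2^q else 0)"
    unfolding h_def using Suc.prems by (intro Suc.IH) auto
  also have "(1 + \<sigma>) * \<dots> = (if i = i' then 2^Suc q else 0)"
  proof -
    have "i = i' \<longleftrightarrow> i div 2 = i' div 2 \<and> odd i = odd i'"
      by (metis even_iff_mod_2_eq_zero div_mult_mod_eq odd_iff_mod_2_eq_one)
    then show ?thesis by (auto simp: \<sigma>_def)
  qed
  finally show ?case .
qed simp

text \<open>
  As the matrix is symmetric with constant first row, this is the orthogonality of row \<open>j\<close> to row \<open>0\<close>.
\<close>

lemma sum_sylvester_column:
  assumes "j < 2^q"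
  shows "(\<Sum>i<2^q. sylvester q i j) = (if j = 0 then 2^q else 0)"
  using sylvester_orthogonal[of 0 q j] assms
  by (simp add: sylvester_zero sylvester_sym[of q 0] sylvester_sym[of q j] eq_commute[of 0 j])

section \<open>Biorthogonal families in normalised basic sequences\<close>

text \<open>
  The coordinate functionals are defined on the whole space, not only on the closed span of \<open>u\<close>: the
  functionals of the renorming are linear combinations of them.
\<close>

locale normalised_basic_sequence =
  fixes u :: "nat \<Rightarrow> 'a::real_normed_vector" and c :: "nat \<Rightarrow> 'a \<Rightarrow> real" and K :: real
  assumes norm_u: "norm (u n) = 1"
    and linear_c: "linear (c n)"
    and c_u: "c n (u m) = (if n = m then 1 else 0)"
    and K_pos: "K > 0"
    and partial_sum: "norm (\<Sum>n<m. c n x *\<^sub>R u n) \<le> K * norm x"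
begin

lemma interval_sum: "norm (\<Sum>n=m..<M. c n x *\<^sub>R u n) \<le> 2 * K * norm x"
proof (cases "m \<le> M")
  case True
  have "{..<M} = {..<m} \<union> {m..<M}" using True by auto
  then have "(\<Sum>n<M. c n x *\<^sub>R u n) = (\<Sum>n<m. c n x *\<^sub>R u n) + (\<Sum>n=m..<M. c n x *\<^sub>R u n)"
    by (simp add: sum.union_disjoint ivl_disj_int)
  then have eq: "(\<Sum>n=m..<M. c n x *\<^sub>R u n) = (\<Sum>n<M. c n x *\<^sub>R u n) - (\<Sum>n<m. c n x *\<^sub>R u n)"
    by simp
  show ?thesis
    unfolding eq using norm_triangle_ineq4[of "\<Sum>n<M. c n x *\<^sub>R u n" "\<Sum>n<m. c n x *\<^sub>R u n"]
      partial_sum[of x M] partial_sum[of x m] by linarith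
next
  case False
  then show ?thesis using K_pos by simp
qed

lemma coordinate_bound: "\<bar>c n x\<bar> \<le> 2 * K * norm x"
  using interval_sum[of x n "Suc n"] by (simp add: norm_u)

lemma bounded_linear_c: "bounded_linear (c n)"
  using linear_c coordinate_bound
  by (intro bounded_linear_intro[of _ "2 * K"])
     (auto simp: linear_add linear_cmul mult.commute)

text \<open>
  The hypotheses of \<open>relative_daugavet_renorming\<close> for the point \<open>u 0\<close> and the functional \<open>c 0\<close>.
\<close>

definition null_hull_system :: "'i set \<Rightarrow> ('i \<Rightarrow> 'a) \<Rightarrow> ('i \<Rightarrow> 'a \<Rightarrow> real) \<Rightarrow> real \<Rightarrow> bool" where
  "null_hull_system I x g G \<longleftrightarrow>
     (\<forall>i\<in>I. norm (x i) \<le> 1 \<and> c 0 (x i) = 0 \<and> linear (g i) \<and> g i (u 0) = 0 \<and>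
        (\<forall>y. \<bar>g i y\<bar> \<le> G * norm y) \<and> (\<forall>j\<in>I. g i (x j) = (if i = j then 1 else 0))) \<and>
     0 \<in> closure (convex hull (x ` I))"

text \<open>
  The case in which no tail is an \<open>\<ell>\<^sub>1\<close>-sequence.  The bounds \<open>\<mu> k\<close> cut the positive
  indices into blocks; on the block \<open>[\<mu> k, \<mu> (k + 1))\<close> there are coefficients whose combination has norm
  less than \<open>1 / (\<mu> k + 1)\<close> times their absolute sum.  Giving each \<open>u n\<close> the sign of its coefficient turns this
  combination, once normalised, into a convex one.  Since the blocks are disjoint, the signs do not conflict.
\<close>

lemma signed_coordinates:
  assumes small: "\<And>\<delta> m. \<delta> > 0 \<Longrightarrow>
      \<exists>M b. norm (\<Sum>n=m..<M. b n *\<^sub>R u n) < \<delta> * (\<Sum>n=m..<M. \<bar>b n\<bar>)"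
  shows "\<exists>(x :: nat \<Rightarrow> 'a) g. null_hull_system {1..} x g (2 * K)"
proof -
  have "\<forall>m. \<exists>M b. norm (\<Sum>n=m..<M. b n *\<^sub>R u n) < inverse (real (Suc m)) * (\<Sum>n=m..<M. \<bar>b n\<bar>)"
    using small by simp
  then obtain M b where Mb: "\<And>m. norm (\<Sum>n=m..<M m. b m n *\<^sub>R u n) < inverse (real (Suc m)) * (\<Sum>n=m..<M m. \<bar>b m n\<bar>)"
    by metis
  \<comment> \<open>the strict inequality fails for the empty sum\<close>
  have M_gt: "m < M m" for m
    using Mb[of m] by (cases "m < M m") auto
  define \<mu> where "\<mu> k = (M ^^ k) 1" for k
  have \<mu>: "\<mu> 0 = 1" "\<mu> (Suc k) = M (\<mu> k)" for k by (auto simp: \<mu>_def)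
  have \<mu>_mono: "strict_mono \<mu>" by (simp add: strict_mono_Suc_iff \<mu> M_gt)
  define block where "block n = (LEAST k. n < \<mu> (Suc k))" for n
  have block: "block n = k" if "\<mu> k \<le> n" "n < \<mu> (Suc k)" for n k
    unfolding block_def
  proof (rule Least_equality)
    show "k \<le> k'" if "n < \<mu> (Suc k')" for k'
    proof (rule ccontr)
      assume "\<not> k \<le> k'"
      then have "\<mu> (Suc k') \<le> \<mu> k" using \<mu>_mono by (simp add: strict_mono_less_eq)
      then show False using that \<open>\<mu> k \<le> n\<close> by simp
    qed
  qed fact
  define \<theta> :: "nat \<Rightarrow> real" where "\<theta> n = (if b (\<mu> (block n)) n < 0 then -1 else 1)" for n
  have \<theta>: "\<theta> n * \<theta> n = 1" "\<bar>\<theta> n\<bar> = 1" for n by (auto simp: \<theta>_def)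
  define x where "x n = \<theta> n *\<^sub>R u n" for n
  have "0 \<in> closure (convex hull (x ` {1..}))"
    unfolding closure_approachable
  proof (intro allI impI)
    fix \<delta> :: real assume "\<delta> > 0"
    then obtain k where k: "inverse (real (Suc k)) < \<delta>" using reals_Archimedean by blast
    define B where "B = {\<mu> k..<\<mu> (Suc k)}"
    define s where "s = (\<Sum>n\<in>B. \<bar>b (\<mu> k) n\<bar>)"
    have lt: "norm (\<Sum>n\<in>B. b (\<mu> k) n *\<^sub>R u n) < inverse (real (Suc (\<mu> k))) * s"
      using Mb[of "\<mu> k"] by (simp add: B_def s_def \<mu>)
    then have "0 < inverse (real (Suc (\<mu> k))) * s" using norm_ge_zero le_less_trans by blast
    then have "s > 0" by (simp add: zero_less_mult_iff)
    define v where "v = (\<Sum>n\<in>B. (\<bar>b (\<mu> k) n\<bar> / s) *\<^sub>R x n)"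
    have "v \<in> convex hull (x ` {1..})"
      unfolding v_def
    proof (rule convex_sum)
      show "(\<Sum>n\<in>B. \<bar>b (\<mu> k) n\<bar> / s) = 1"
        using \<open>s > 0\<close> by (simp add: s_def flip: sum_divide_distrib)
      show "x n \<in> convex hull (x ` {1..})" if "n \<in> B" for n
      proof -
        have "1 \<le> \<mu> k" using \<mu>_mono \<mu>(1) by (metis le0 strict_mono_less_eq)
        then have "n \<in> {1..}" using that by (auto simp: B_def)
        then show ?thesis by (intro hull_inc imageI)
      qed
    qed (use \<open>s > 0\<close> in \<open>auto simp: B_def convex_convex_hull\<close>)
    moreover have "norm v < \<delta>"
    proof -
      have "(\<bar>b (\<mu> k) n\<bar> / s) *\<^sub>R x n = inverse s *\<^sub>R (b (\<mu> k) n *\<^sub>R u n)" if "n \<in> B" for n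
        using that block[of k n] by (auto simp: x_def \<theta>_def B_def divide_inverse mult.commute)
      then have "v = inverse s *\<^sub>R (\<Sum>n\<in>B. b (\<mu> k) n *\<^sub>R u n)"
        unfolding v_def scaleR_sum_right by (rule sum.cong[OF refl])
      then have "norm v < inverse (real (Suc (\<mu> k)))"
        using lt \<open>s > 0\<close> by (simp add: field_simps)
      also have "\<dots> \<le> inverse (real (Suc k))"
        using strict_mono_imp_increasing[OF \<mu>_mono, of k] by (simp add: field_simps)
      finally show ?thesis using k by simp
    qed
    ultimately show "\<exists>y\<in>convex hull (x ` {1..}). dist y 0 < \<delta>" by auto
  qed
  then have "null_hull_system {1..} x (\<lambda>n y. \<theta> n * c n y) (2 * K)"
    unfolding null_hull_system_def
    using coordinate_bound linear_c
    by (auto simp: x_def norm_u \<theta> linear_cmul[OF linear_c] c_u abs_mult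
        intro!: linear_compose_scale_right[where f = "c _", simplified])
  then show ?thesis by blast
qed

text \<open>
  The case of an \<open>\<ell>\<^sub>1\<close>-tail.  The lower estimate bounds \<open>\<Sum> \<bar>c\<^sub>n y\<bar>\<close> over the tail by a multiple of
  \<open>\<parallel>y\<parallel>\<close>, so all functionals with coefficients \<open>\<plusminus>1\<close> on finitely many tail coordinates have a common
  bound.  The rows of the Hadamard matrix of order \<open>2^q\<close>, placed on a block of that length, are thus
  admissible functionals, biorthogonal to the rows divided by \<open>2^q\<close>; the average of the latter is
  \<open>2^-q\<close> times the first basis vector of the block.
\<close>

lemma sylvester_blocks:
  assumes "\<delta> > 0" and lower: "\<And>M b. \<delta> * (\<Sum>n=m..<M. \<bar>b n\<bar>) \<le> norm (\<Sum>n=m..<M. b n *\<^sub>R u n)"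
  shows "\<exists>(x :: nat \<times> nat \<Rightarrow> 'a) g. null_hull_system (SIGMA q:UNIV. {..<2^q}) x g (2 * K / \<delta>)"
proof -
  \<comment> \<open>column \<open>j\<close> of block \<open>q\<close>; the offset \<open>2^q\<close> keeps the blocks disjoint and away from the index \<open>0\<close>\<close>
  define v where "v q j = m + 2^q + j" for q j :: nat
  define x where "x = (\<lambda>(q, i). \<Sum>j<2^q. (sylvester q i j / 2^q) *\<^sub>R u (v q j))"
  define g where "g = (\<lambda>(q, i) y. \<Sum>j<2^q. sylvester q i j * c (v q j) y)"
  have v_inj: "v q j = v q' j' \<longleftrightarrow> q = q' \<and> j = j'" if "j < 2^q" "j' < 2^q'" for q q' j j'
  proof -
    have "2^q + j < 2^q' + j'" if "q < q'" "j < 2^q" for q q' j j' :: nat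
    proof -
      have "2 ^ Suc q \<le> (2::nat) ^ q'" using that by (intro power_increasing) auto
      then show ?thesis using that by simp
    qed
    from this[of q q' j j'] this[of q' q j' j] that show ?thesis
      by (cases q q' rule: linorder_cases) (auto simp: v_def)
  qed
  have v_nz: "c 0 (u (v q j)) = 0" "c (v q j) (u 0) = 0" for q j
    unfolding c_u by (simp_all add: v_def)
  have c_x: "c (v q j) (x (q', i)) = (if q = q' then sylvester q i j / 2^q else 0)"
    if "j < 2^q" for q q' i j
  proof -
    have "c (v q j) (x (q', i)) = (\<Sum>j'<2^q'. sylvester q' i j' / 2^q' * (if q = q' \<and> j = j' then 1 else 0))"
      unfolding x_def prod.case linear_sum[OF linear_c] linear_cmul[OF linear_c] c_u
      using that by (intro sum.cong) (auto simp: v_inj)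
    then show ?thesis using that by (cases "q = q'") (auto simp: if_distrib cong: if_cong)
  qed
  have "norm (x (q, i)) \<le> 1" for q i
  proof -
    have "norm (x (q, i)) \<le> (\<Sum>j<2^q. norm ((sylvester q i j / 2^q) *\<^sub>R u (v q j)))"
      unfolding x_def prod.case by (rule norm_sum)
    also have "\<dots> = 1" by (simp add: norm_u abs_sylvester)
    finally show ?thesis .
  qed
  moreover have "c 0 (x (q, i)) = 0" for q i
    by (simp add: x_def linear_sum[OF linear_c] linear_cmul[OF linear_c] v_nz)
  moreover have "linear (g (q, i))" for q i
    unfolding g_def prod.case
    by (rule linearI) (simp_all add: linear_add[OF linear_c] linear_cmul[OF linear_c] sum.distrib
        sum_distrib_left algebra_simps)
  moreover have "g (q, i) (u 0) = 0" for q i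
    by (simp add: g_def v_nz)
  moreover have "\<bar>g (q, i) y\<bar> \<le> 2 * K / \<delta> * norm y" for q i y
  proof -
    have "\<bar>g (q, i) y\<bar> \<le> (\<Sum>j<2^q. \<bar>c (v q j) y\<bar>)"
      unfolding g_def prod.case
      by (rule order_trans[OF sum_abs]) (simp add: abs_mult abs_sylvester)
    also have "\<dots> = (\<Sum>n\<in>v q ` {..<2^q}. \<bar>c n y\<bar>)"
      by (simp add: sum.reindex inj_on_def v_def)
    also have "\<dots> \<le> (\<Sum>n=m..<v q (2^q). \<bar>c n y\<bar>)"
      by (rule sum_mono2) (auto simp: v_def)
    also have "\<dots> \<le> 2 * K / \<delta> * norm y"
      using order_trans[OF lower interval_sum] \<open>\<delta> > 0\<close> by (simp add: field_simps)
    finally show ?thesis .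
  qed
  moreover have "g (q, i) (x (q', i')) = (if (q, i) = (q', i') then 1 else 0)"
    if "i < 2^q" "i' < 2^q'" for q q' i i'
  proof -
    have "g (q, i) (x (q', i')) = (\<Sum>j<2^q. if q = q' then sylvester q i j * sylvester q i' j / 2^q else 0)"
      unfolding g_def prod.case by (intro sum.cong) (auto simp: c_x)
    also have "\<dots> = (if q = q' then (\<Sum>j<2^q. sylvester q i j * sylvester q i' j) / 2^q else 0)"
      by (simp add: sum_divide_distrib)
    finally show ?thesis using that by (auto simp: sylvester_orthogonal)
  qed
  moreover have "0 \<in> closure (convex hull (x ` (SIGMA q:UNIV. {..<2^q})))"
    unfolding closure_approachable
  proof (intro allI impI)
    fix \<eta> :: real assume "\<eta> > 0"
    then obtain q where q: "inverse (2::real) ^ q < \<eta>"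
      using real_arch_pow_inv[of \<eta> "inverse 2"] by auto
    define w where "w = (\<Sum>i<2^q. (1 / 2^q) *\<^sub>R x (q, i))"
    have "w \<in> convex hull (x ` (SIGMA q:UNIV. {..<2^q}))"
      unfolding w_def by (rule convex_sum) (auto intro!: hull_inc imageI convex_convex_hull)
    moreover have "norm w < \<eta>"
    proof -
      have "w = (\<Sum>j<2^q. \<Sum>i<2^q. (1 / 2^q) *\<^sub>R ((sylvester q i j / 2^q) *\<^sub>R u (v q j)))"
        unfolding w_def x_def prod.case scaleR_sum_right by (rule sum.swap)
      also have "\<dots> = (\<Sum>j<2^q. ((\<Sum>i<2^q. sylvester q i j) / (2^q * 2^q)) *\<^sub>R u (v q j))"
        by (simp add: sum_divide_distrib scaleR_sum_left)
      also have "\<dots> = (\<Sum>j<2^q::nat. if j = 0 then (1 / 2^q) *\<^sub>R u (v q 0) else 0)"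
        by (intro sum.cong) (auto simp: sum_sylvester_column)
      also have "\<dots> = (1 / 2^q) *\<^sub>R u (v q 0)" by simp
      finally have "norm w = inverse 2 ^ q"
        by (simp add: norm_u inverse_eq_divide power_one_over)
      then show ?thesis using q by simp
    qed
    ultimately show "\<exists>y\<in>convex hull (x ` (SIGMA q:UNIV. {..<2^q})). dist y 0 < \<eta>" by auto
  qed
  ultimately have "null_hull_system (SIGMA q:UNIV. {..<2^q}) x g (2 * K / \<delta>)"
    unfolding null_hull_system_def by auto
  then show ?thesis by blast
qed

lemma null_hull_system_renorming:
  assumes "null_hull_system I x g G"
  shows "\<exists>N :: 'a \<Rightarrow> real. equivalent_norm N \<and> (\<exists>z. relative_daugavet_point N z)"
proof -
  have "bounded (x ` I)"
    using assms by (auto simp: null_hull_system_def intro: boundedI)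
  moreover have "c 0 (u 0) = 1" by (simp add: c_u)
  ultimately obtain N where "equivalent_norm N" "relative_daugavet_point N (u 0)"
    using relative_daugavet_renorming[of "c 0" "u 0" I x g G] assms bounded_linear_c
    unfolding null_hull_system_def by blast
  then show ?thesis by blast
qed

lemma exists_renorming: "\<exists>N :: 'a \<Rightarrow> real. equivalent_norm N \<and> (\<exists>z. relative_daugavet_point N z)"
proof (cases "\<exists>\<delta>>0. \<exists>m. \<forall>M b. \<delta> * (\<Sum>n=m..<M. \<bar>b n\<bar>) \<le> norm (\<Sum>n=m..<M. b n *\<^sub>R u n)")
  case True
  then obtain \<delta> m where "\<delta> > 0"
    and "\<And>M b. \<delta> * (\<Sum>n=m..<M. \<bar>b n\<bar>) \<le> norm (\<Sum>n=m..<M. b n *\<^sub>R u n)"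
    by blast
  from sylvester_blocks[OF this] show ?thesis
    by (elim exE) (rule null_hull_system_renorming)
next
  case False
  then have small: "\<exists>M b. norm (\<Sum>n=m..<M. b n *\<^sub>R u n) < \<delta> * (\<Sum>n=m..<M. \<bar>b n\<bar>)" if "\<delta> > 0" for \<delta> m
    using that by (meson not_le)
  have "\<exists>(x :: nat \<Rightarrow> 'a) g. null_hull_system {1..} x g (2 * K)"
    by (rule signed_coordinates) (rule small)
  then show ?thesis
    by (elim exE) (rule null_hull_system_renorming)
qed

end

section \<open>Renorming spaces with a Schauder basis\<close>

theorem theorem3p11:
  fixes e :: "nat \<Rightarrow> 'a::banach"
  assumes infinite_dim: "\<not> (\<exists>B::'a set. finite B \<and> span B = UNIV)"
    and basis: "schauder_basis e"
    and weakly_null: "weakly_null e"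
  shows "\<exists>N::'a \<Rightarrow> real. equivalent_norm N \<and> (\<exists>z. relative_daugavet_point N z)"
proof (rule schauder_basis_normalised[OF basis])
  fix u :: "nat \<Rightarrow> 'a" and c K
  assume "\<And>n. norm (u n) = 1" "\<And>n. linear (c n)"
    "\<And>n m. c n (u m) = (if n = m then 1 else 0)"
    "K > 0" "\<And>m x. norm (\<Sum>n<m. c n x *\<^sub>R u n) \<le> K * norm x"
  then interpret normalised_basic_sequence u c K
    by (rule normalised_basic_sequence.intro)
  show ?thesis by (rule exists_renorming)
qed

end
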